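(* Let $h_{2,2}:\mathbb{T}^2\times\mathbb{T}^2\to\mathbb{H}\simeq\mathbb{R}^4$ be the map $$h_{2,2}\bigl((x,s),(t,y)\bigr)=e^{xi}\,c(s)\,d(t)\,e^{yi},$$ where $c,d:\mathbb{S}^1\to\mathbb{H}$ are the explicit smooth loops $$c(s)=\overline{\sigma\bigl(4i+2\gamma_{1/4}(s)\bigr)},\qquad d(t)=\sigma\bigl(4i+2\gamma_{1/8}(t)\bigr)$$ with $\sigma$ and $\gamma_\lambda$ as defined in the context. Then $h_{2,2}$ has everywhere invertible mixed Hessian, namely $h_{2,2}\in P_{2,2}$.
   Context: $\mathbb{T}^m=\mathbb{R}^m/2\pi\mathbb{Z}^m$ and $\mathbb{S}^1=\mathbb{R}/2\pi\mathbb{Z}$. $\mathbb{H}$ denotes the quaternions, identified with $\mathbb{R}^4$ via $(a_0,a_1,a_2,a_3)\mapsto a_0+a_1i+a_2j+a_3k$; $\mathrm{Im}\,\mathbb{H}\simeq\mathbb{R}^3$ are the imaginary quaternions; $\langle a,b\rangle=\mathrm{Re}(a\bar b)$ is the Euclidean product; $e^{xi}=\cos x+i\sin x$. For $\xi\in\mathrm{Im}\,\mathbb{H}$ put $\rho=|\xi|$, $\xi_1=\langle\xi,i\rangle$, and, when $\rho+\xi_1>0$, set $\sigma(\xi)=\dfrac{\rho-\xi i}{\sqrt{2(\rho+\xi_1)}}\in\mathbb{H}$ (quaternionic product $\xi i$). For $\lambda\in(0,1/2)$ let $\gamma_\lambda:\mathbb{S}^1\to\mathrm{Im}\,\mathbb{H}$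 be $$\gamma_\lambda(s)=i\bigl(\sin s+\tfrac{\lambda}{2}\cos2s+\tfrac{\lambda}{4}\cos4s\bigr)+j\bigl(-\cos s-\tfrac{\lambda}{2}\sin2s+\tfrac{\lambda}{4}\sin4s\bigr)+k\bigl(-\tfrac{1-2\lambda^2}{3}\cos3s+\tfrac{\lambda}{6}\sin6s\bigr),$$ whose derivative is $\gamma_\lambda'(s)=(1-2\lambda\sin3s)\bigl(i\cos s+j\sin s+k(\lambda+\sin3s)\bigr)$. The arguments of $\sigma$ in the definition of $c$ and $d$ lie in the region $\rho+\xi_1>0$. A $C^\infty$ map $h:\mathbb{T}^a\times\mathbb{T}^b\to\mathbb{R}^{ab}$ has invertible mixed Hessian at a point if the $ab$ vectors $\frac{\partial^2h}{\partial x^i\partial y^\alpha}$ ($x^i$ the coordinates on $\mathbb{T}^a$, $y^\alpha$ those on $\mathbb{T}^b$) form a basis of $\mathbb{R}^{ab}$ at that point; $P_{a,b}$ is the set of all such $h$ for which this holds at every point. Here the coordinates on the first $\mathbb{T}^2$ are $(x,s)$ and on the second $(t,y)$. *)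

theory Defs
  imports "HOL-Analysis.Analysis"
begin

subsection \<open>Quaternions as \<open>real^4\<close>\<close>

text \<open>
  The components \<open>$1\<close>, \<open>$2\<close>, \<open>$3\<close>, \<open>$4\<close> are the coefficients of \<open>1\<close>, \<open>i\<close>, \<open>j\<close>, \<open>k\<close>, so that the
  library's \<open>norm\<close> and inner product on \<open>real^4\<close> are the quaternionic modulus and
  \<open>Re (a * cnj b)\<close>.  The library's \<open>*\<close> on \<open>real^4\<close> is componentwise, hence a separate symbol
  for the quaternionic product.
\<close>

type_synonym quat = "real^4"

definition qmult :: "quat \<Rightarrow> quat \<Rightarrow> quat"  (infixl \<open>\<odot>\<close> 70) where
  "a \<odot> b = vector
     [a$1 * b$1 - a$2 * b$2 - a$3 * b$3 - a$4 * b$4,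
      a$1 * b$2 + a$2 * b$1 + a$3 * b$4 - a$4 * b$3,
      a$1 * b$3 - a$2 * b$4 + a$3 * b$1 + a$4 * b$2,
      a$1 * b$4 + a$2 * b$3 - a$3 * b$2 + a$4 * b$1]"

definition qone :: quat where "qone = vector [1, 0, 0, 0]"
definition qi :: quat where "qi = vector [0, 1, 0, 0]"
definition qj :: quat where "qj = vector [0, 0, 1, 0]"
definition qk :: quat where "qk = vector [0, 0, 0, 1]"

definition qcnj :: "quat \<Rightarrow> quat" where
  "qcnj a = vector [a$1, - a$2, - a$3, - a$4]"

definition qexpi :: "real \<Rightarrow> quat" where
  "qexpi x = cos x *\<^sub>R qone + sin x *\<^sub>R qi"

lemma vector_4_nth [simp]:
  "(vector [a, b, c, d] :: 'a::zero^4) $ 1 = a"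
  "(vector [a, b, c, d] :: 'a::zero^4) $ 2 = b"
  "(vector [a, b, c, d] :: 'a::zero^4) $ 3 = c"
  "(vector [a, b, c, d] :: 'a::zero^4) $ 4 = d"
  by (simp_all add: vector_def)

lemma quat_eq_iff: "a = b \<longleftrightarrow> a$1 = b$1 \<and> a$2 = b$2 \<and> a$3 = b$3 \<and> a$4 = b$4" for a b :: quat
  by (simp add: vec_eq_iff forall_4)

lemma qmult_units:
  "qi \<odot> qi = - qone" "qj \<odot> qj = - qone" "qk \<odot> qk = - qone"
  "qi \<odot> qj = qk" "qj \<odot> qk = qi" "qk \<odot> qi = qj"
  "qj \<odot> qi = - qk" "qk \<odot> qj = - qi" "qi \<odot> qk = - qj"
  by (simp_all add: quat_eq_iff qmult_def qone_def qi_def qj_def qk_def)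

lemma qmult_one: "qone \<odot> a = a" "a \<odot> qone = a"
  by (simp_all add: quat_eq_iff qmult_def qone_def)

lemma qmult_assoc: "(a \<odot> b) \<odot> c = a \<odot> (b \<odot> c)"
  by (simp add: quat_eq_iff qmult_def algebra_simps)

lemma bilinear_qmult: "bilinear (\<odot>)"
  by (auto simp: bilinear_def linear_iff quat_eq_iff qmult_def algebra_simps)

lemma inner_eq_Re_qmult_qcnj: "a \<bullet> b = (a \<odot> qcnj b) $ 1"
  by (simp add: inner_vec_def sum_4 qmult_def qcnj_def)


subsection \<open>The loops\<close>

definition quat_sigma :: "quat \<Rightarrow> quat" where
  "quat_sigma \<xi> = (norm \<xi> *\<^sub>R qone - \<xi> \<odot> qi) /\<^sub>R sqrt (2 * (norm \<xi> + \<xi> \<bullet> qi))"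

definition gamma_curve :: "real \<Rightarrow> real \<Rightarrow> quat" where
  "gamma_curve lam s =
     (sin s + lam / 2 * cos (2 * s) + lam / 4 * cos (4 * s)) *\<^sub>R qi
   + (- cos s - lam / 2 * sin (2 * s) + lam / 4 * sin (4 * s)) *\<^sub>R qj
   + (- (1 - 2 * lam\<^sup>2) / 3 * cos (3 * s) + lam / 6 * sin (6 * s)) *\<^sub>R qk"

definition loop_c :: "real \<Rightarrow> quat" where
  "loop_c s = qcnj (quat_sigma (4 *\<^sub>R qi + 2 *\<^sub>R gamma_curve (1/4) s))"

definition loop_d :: "real \<Rightarrow> quat" where
  "loop_d t = quat_sigma (4 *\<^sub>R qi + 2 *\<^sub>R gamma_curve (1/8) t)"

text \<open>
  \<open>quat_sigma\<close> is meaningful only where \<open>norm \<xi> + \<xi> \<bullet> qi > 0\<close>; its arguments in the two loops are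
  imaginary and satisfy this.
\<close>

lemma quat_sigma_argument:
  assumes "0 < lam" "lam < 1/2"
  defines "\<xi> \<equiv> \<lambda>s. 4 *\<^sub>R qi + 2 *\<^sub>R gamma_curve lam s"
  shows "\<xi> s $ 1 = 0" and "norm (\<xi> s) + \<xi> s \<bullet> qi > 0"
proof -
  show "\<xi> s $ 1 = 0"
    by (simp add: \<xi>_def gamma_curve_def qi_def qj_def qk_def)
  define A B where "A = lam / 2 * cos (2 * s)" and "B = lam / 4 * cos (4 * s)"
  have "\<bar>A\<bar> \<le> lam / 2" "\<bar>B\<bar> \<le> lam / 4"
    using assms by (simp_all add: A_def B_def abs_mult mult_left_le)
  then have "A \<ge> - 1/4" "B \<ge> - 1/8"
    using assms(1,2) by linarith+
  moreover define S where "S = sin s"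
  moreover have "S \<ge> - 1"
    by (simp add: S_def)
  ultimately have "4 + 2 * (S + A + B) > 0"
    by argo
  then have "\<xi> s \<bullet> qi > 0"
    by (simp add: S_def A_def B_def \<xi>_def gamma_curve_def inner_vec_def sum_4 qi_def qj_def qk_def)
  then show "norm (\<xi> s) + \<xi> s \<bullet> qi > 0"
    by (simp add: add_nonneg_pos)
qed


subsection \<open>Smooth maps on products of tori with invertible mixed Hessian\<close>

text \<open>
  For \<open>k \<ge> 1\<close>, a map is \<open>C^k\<close> iff it is differentiable and all its directional derivatives are
  \<open>C^(k-1)\<close>.
\<close>

fun C_k :: "nat \<Rightarrow> ('e::euclidean_space \<Rightarrow> 'v::euclidean_space) \<Rightarrow> bool" where
  "C_k 0 f \<longleftrightarrow> continuous_on UNIV f"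
| "C_k (Suc k) f \<longleftrightarrow>
     (\<forall>x. f differentiable (at x)) \<and> (\<forall>v. C_k k (\<lambda>x. frechet_derivative f (at x) v))"

definition C_infinity :: "('e::euclidean_space \<Rightarrow> 'v::euclidean_space) \<Rightarrow> bool" where
  "C_infinity f \<longleftrightarrow> (\<forall>k. C_k k f)"

text \<open>
  Maps on the torus \<open>\<real>^m / 2\<pi>\<int>^m\<close> are represented by maps on \<open>\<real>^m\<close> that are \<open>2\<pi>\<close>-periodic in each
  coordinate; such a map is smooth on the torus iff it is smooth on \<open>\<real>^m\<close>.
\<close>

definition torus_periodic :: "((real^'a) \<times> (real^'b) \<Rightarrow> 'v) \<Rightarrow> bool" where
  "torus_periodic h \<longleftrightarrow>
     (\<forall>p q i. h (p + (2 * pi) *\<^sub>R axis i 1, q) = h (p, q)) \<and>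
     (\<forall>p q \<alpha>. h (p, q + (2 * pi) *\<^sub>R axis \<alpha> 1) = h (p, q))"

definition mixed_partial ::
  "((real^'a) \<times> (real^'b) \<Rightarrow> 'v::real_normed_vector) \<Rightarrow> real^'a \<Rightarrow> real^'b \<Rightarrow> 'a \<times> 'b \<Rightarrow> 'v" where
  "mixed_partial h p q = (\<lambda>(i, \<alpha>).
     vector_derivative
       (\<lambda>u. vector_derivative (\<lambda>v. h (p + u *\<^sub>R axis i 1, q + v *\<^sub>R axis \<alpha> 1)) (at 0))
       (at 0))"

text \<open>Injectivity is required because the basis condition is on the indexed family.\<close>

definition invertible_mixed_hessian ::
  "((real^'a) \<times> (real^'b) \<Rightarrow> real^'n) \<Rightarrow> real^'a \<Rightarrow> real^'b \<Rightarrow> bool" where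
  "invertible_mixed_hessian h p q \<longleftrightarrow>
     inj (mixed_partial h p q) \<and>
     independent (range (mixed_partial h p q)) \<and>
     span (range (mixed_partial h p q)) = UNIV"

text \<open>
  \<open>P_{a,b}\<close> with \<open>a = CARD('a)\<close> and \<open>b = CARD('b)\<close>.
\<close>

definition P_set :: "((real^'a) \<times> (real^'b) \<Rightarrow> real^'n) set" where
  "P_set = {h. CARD('n) = CARD('a) * CARD('b) \<and> C_infinity h \<and> torus_periodic h \<and>
               (\<forall>p q. invertible_mixed_hessian h p q)}"


subsection \<open>The map\<close>

definition h22 :: "(real^2) \<times> (real^2) \<Rightarrow> real^4" where
  "h22 = (\<lambda>(p, q). let x = p$1; s = p$2; t = q$1; y = q$2 in
            qexpi x \<odot> loop_c s \<odot> loop_d t \<odot> qexpi y)"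

end

theory Submission
  imports Defs
begin

text \<open>
  The map is a product \<open>h (p, q) = F p \<odot> G q\<close> of \<open>F (x, s) = e\<^sup>x\<^sup>i \<odot> c s\<close> and
  \<open>G (t, y) = d t \<odot> e\<^sup>y\<^sup>i\<close>, so its mixed partials are the four products \<open>F\<^sub>i \<odot> G\<^sub>\<alpha>\<close> of the partials
  of \<open>F\<close> and of \<open>G\<close>.  When is such a family a basis of the quaternions?  Multiplying by the
  conjugate of \<open>F\<^sub>1\<close> on the left and of \<open>G\<^sub>2\<close> on the right turns it, up to nonzero real factors,
  into \<open>1, P, Q, P \<odot> Q\<close> with \<open>P = qcnj F\<^sub>1 \<odot> F\<^sub>2\<close> and \<open>Q = G\<^sub>1 \<odot> qcnj G\<^sub>2\<close>.  These four are linearly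
  independent as soon as \<open>P\<close> and \<open>Q\<close> do not commute (\<open>one_P_Q_PQ_independent\<close>), and quaternions
  commute exactly when their imaginary parts are parallel.

  The map \<open>quat_sigma\<close> is a local section of the Hopf map \<open>g \<mapsto> g \<odot> i \<odot> qcnj g\<close>
  (\<open>quat_sigma_conjugates_i\<close>).  Hence if \<open>g\<close> denotes \<open>quat_sigma\<close> along the curve \<open>4 i + 2 \<gamma>\<close>,
  differentiating \<open>g \<odot> i \<odot> qcnj g = 4 i + 2 \<gamma>\<close> shows that the imaginary part of
  \<open>g' \<odot> i \<odot> qcnj g\<close> is \<open>\<gamma>'\<close> (\<open>lifted_loop_derivative\<close>).  The factors \<open>e\<^sup>x\<^sup>i\<close> and \<open>e\<^sup>y\<^sup>i\<close> cancel in \<open>P\<close>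
  and \<open>Q\<close>, whose imaginary parts turn out to be \<open>- \<gamma>'\<close> for the parameters \<open>1/4\<close> and \<open>1/8\<close>.

  So everything rests on the tangents of the two curves never being parallel
  (\<open>gamma_tangents_do_not_commute\<close>).  The tangent direction is \<open>(cos s, sin s, \<lambda> + sin 3s)\<close>.
  If the directions at \<open>(\<lambda>, s)\<close> and \<open>(\<mu>, t)\<close> are parallel, the first two coordinates force
  \<open>t = s\<close> or \<open>t = s + \<pi>\<close> modulo \<open>2\<pi>\<close>; then \<open>sin 3t = \<plusminus> sin 3s\<close> with the same sign, and the third
  coordinate gives \<open>\<mu> = \<plusminus> \<lambda>\<close>, which is impossible for distinct positive parameters.
\<close>

section \<open>Closure properties of smooth maps\<close>

text \<open>
  The recursion defining \<open>C_k\<close> is stated with \<open>frechet_derivative\<close>; the next two rules let an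
  induction on the order work with any explicit derivative instead.  Every closure property
  below then follows because the derivative of the compound map is again built from the given
  maps and their derivatives.
\<close>

lemma C_k_SucI:
  assumes "\<And>x. (f has_derivative f' x) (at x)" "\<And>v. C_k k (\<lambda>x. f' x v)"
  shows "C_k (Suc k) f"
proof -
  have "frechet_derivative f (at x) = f' x" for x
    using frechet_derivative_at[OF assms(1)[of x]] by simp
  then show ?thesis
    using assms by (auto simp: differentiable_def)
qed

lemma C_k_SucD:
  assumes "C_k (Suc k) f"
  shows "\<exists>f'. (\<forall>x. (f has_derivative f' x) (at x)) \<and> (\<forall>v. C_k k (\<lambda>x. f' x v))"
  using assms by (intro exI[of _ "\<lambda>x. frechet_derivative f (at x)"])
    (simp flip: frechet_derivative_works)

lemma C_k_Suc_imp_C_k: "C_k (Suc k) f \<Longrightarrow> C_k k f"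
proof (induction k arbitrary: f)
  case 0
  then show ?case
    by (auto simp: continuous_on_eq_continuous_at intro: differentiable_imp_continuous_within)
next
  case (Suc k)
  then show ?case
    by (metis C_k.simps(2))
qed

lemma C_k_const: "C_k k (\<lambda>x. c)"
proof (induction k arbitrary: c)
  case (Suc k)
  show ?case
    by (rule C_k_SucI[where f' = "\<lambda>x v. 0"]) (auto simp: Suc)
qed simp

lemma C_k_add:
  "C_k k f \<Longrightarrow> C_k k g \<Longrightarrow> C_k k (\<lambda>x. f x + g x)"
proof (induction k arbitrary: f g)
  case 0
  then show ?case by (auto intro: continuous_intros)
next
  case (Suc k)
  obtain f' where
    f': "\<And>x. (f has_derivative f' x) (at x)" "\<And>v. C_k k (\<lambda>x. f' x v)"
    using C_k_SucD[OF Suc.prems(1)] by blast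
  obtain g' where
    g': "\<And>x. (g has_derivative g' x) (at x)" "\<And>v. C_k k (\<lambda>x. g' x v)"
    using C_k_SucD[OF Suc.prems(2)] by blast
  from f' g' show ?case
    by (intro C_k_SucI[where f' = "\<lambda>x v. f' x v + g' x v"] Suc.IH has_derivative_add)
qed

lemma C_k_bilinear:
  assumes "bounded_bilinear b"
  shows "C_k k f \<Longrightarrow> C_k k g \<Longrightarrow> C_k k (\<lambda>x. b (f x) (g x))"
proof (induction k arbitrary: f g)
  case 0
  then show ?case by (auto intro: bounded_bilinear.continuous_on[OF assms])
next
  case (Suc k)
  obtain f' where
    f': "\<And>x. (f has_derivative f' x) (at x)" "\<And>v. C_k k (\<lambda>x. f' x v)"
    using C_k_SucD[OF Suc.prems(1)] by blast
  obtain g' where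
    g': "\<And>x. (g has_derivative g' x) (at x)" "\<And>v. C_k k (\<lambda>x. g' x v)"
    using C_k_SucD[OF Suc.prems(2)] by blast
  from f' g' show ?case
    using Suc.prems[THEN C_k_Suc_imp_C_k]
    by (intro C_k_SucI[where f' = "\<lambda>x v. b (f x) (g' x v) + b (f' x v) (g x)"]
        C_k_add Suc.IH bounded_bilinear.FDERIV[OF assms])
qed

lemma C_k_bounded_linear:
  assumes "bounded_linear L"
  shows "C_k k f \<Longrightarrow> C_k k (\<lambda>x. L (f x))"
proof (induction k arbitrary: f)
  case 0
  then show ?case by (auto intro: bounded_linear.continuous_on[OF assms])
next
  case (Suc k)
  obtain f' where
    "\<And>x. (f has_derivative f' x) (at x)" "\<And>v. C_k k (\<lambda>x. f' x v)"
    using C_k_SucD[OF Suc.prems] by blast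
  then show ?case
    by (intro C_k_SucI[where f' = "\<lambda>x v. L (f' x v)"] Suc.IH
        bounded_linear.has_derivative[OF assms])
qed

lemma C_k_compose_bounded_linear:
  assumes "bounded_linear L"
  shows "C_k k f \<Longrightarrow> C_k k (\<lambda>x. f (L x))"
proof (induction k arbitrary: f)
  case 0
  then show ?case
    using continuous_on_compose2[of UNIV f UNIV L] linear_continuous_on[OF assms] by auto
next
  case (Suc k)
  obtain f' where
    "\<And>x. (f has_derivative f' x) (at x)" "\<And>v. C_k k (\<lambda>x. f' x v)"
    using C_k_SucD[OF Suc.prems] by blast
  then show ?case
    by (intro C_k_SucI[where f' = "\<lambda>x v. f' (L x) (L v)"] Suc.IH
        has_derivative_compose[OF bounded_linear_imp_has_derivative[OF assms]])
qed

lemma C_k_id: "C_k k (\<lambda>x. x)"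
proof (cases k)
  case (Suc m)
  show ?thesis
    unfolding Suc by (rule C_k_SucI[where f' = "\<lambda>x v. v"]) (auto intro: C_k_const)
qed simp

lemma C_k_mult:
  fixes f g :: "'e::euclidean_space \<Rightarrow> real"
  shows "C_k k f \<Longrightarrow> C_k k g \<Longrightarrow> C_k k (\<lambda>x. f x * g x)"
  by (rule C_k_bilinear[OF bounded_bilinear_mult])

lemma C_k_uminus: "C_k k f \<Longrightarrow> C_k k (\<lambda>x. - f x)"
  by (rule C_k_bounded_linear[OF bounded_linear_minus[OF bounded_linear_ident]])

lemma C_k_diff: "C_k k f \<Longrightarrow> C_k k g \<Longrightarrow> C_k k (\<lambda>x. f x - g x)"
  using C_k_add[of k f "\<lambda>x. - g x"] C_k_uminus[of k g] by simp

lemma C_k_inverse: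
  fixes f :: "'e::euclidean_space \<Rightarrow> real"
  assumes nz: "\<And>x. f x \<noteq> 0"
  shows "C_k k f \<Longrightarrow> C_k k (\<lambda>x. inverse (f x))"
proof (induction k)
  case 0
  then show ?case using nz by (auto intro: continuous_intros)
next
  case (Suc k)
  obtain f' where
    "\<And>x. (f has_derivative f' x) (at x)" "\<And>v. C_k k (\<lambda>x. f' x v)"
    using C_k_SucD[OF Suc.prems] by blast
  moreover have "C_k k (\<lambda>x. inverse (f x))"
    by (rule Suc.IH[OF C_k_Suc_imp_C_k[OF Suc.prems]])
  ultimately show ?case
    using nz
    by (intro C_k_SucI[where f' = "\<lambda>x v. - (inverse (f x) * f' x v * inverse (f x))"]
        C_k_uminus C_k_mult Deriv.has_derivative_inverse)
qed

lemma C_k_sqrt: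
  fixes f :: "'e::euclidean_space \<Rightarrow> real"
  assumes pos: "\<And>x. f x > 0"
  shows "C_k k f \<Longrightarrow> C_k k (\<lambda>x. sqrt (f x))"
proof (induction k)
  case 0
  then show ?case by (auto intro: continuous_intros)
next
  case (Suc k)
  obtain f' where
    "\<And>x. (f has_derivative f' x) (at x)" "\<And>v. C_k k (\<lambda>x. f' x v)"
    using C_k_SucD[OF Suc.prems] by blast
  moreover have "C_k k (\<lambda>x. inverse (sqrt (f x)))"
    using pos by (intro C_k_inverse Suc.IH[OF C_k_Suc_imp_C_k[OF Suc.prems]]) (simp add: less_imp_neq[symmetric])
  ultimately show ?case
    using pos
    by (intro C_k_SucI[where f' = "\<lambda>x v. f' x v * (inverse (sqrt (f x)) * (1/2))"] C_k_mult C_k_const)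
      (auto intro!: derivative_eq_intros simp: field_simps)
qed

lemma C_k_sin_cos:
  fixes f :: "'e::euclidean_space \<Rightarrow> real"
  shows "C_k k f \<Longrightarrow> C_k k (\<lambda>x. sin (f x)) \<and> C_k k (\<lambda>x. cos (f x))"
proof (induction k)
  case 0
  then show ?case by (auto intro: continuous_intros)
next
  case (Suc k)
  obtain f' where
    "\<And>x. (f has_derivative f' x) (at x)" "\<And>v. C_k k (\<lambda>x. f' x v)"
    using C_k_SucD[OF Suc.prems] by blast
  moreover have "C_k k (\<lambda>x. sin (f x))" "C_k k (\<lambda>x. cos (f x))"
    using Suc.IH[OF C_k_Suc_imp_C_k[OF Suc.prems]] by auto
  ultimately show ?case
    by (intro conjI C_k_SucI[where f' = "\<lambda>x v. cos (f x) * f' x v"]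
        C_k_SucI[where f' = "\<lambda>x v. - (sin (f x) * f' x v)"] C_k_mult C_k_uminus)
      (auto intro!: derivative_eq_intros)
qed

lemmas C_k_sin = C_k_sin_cos[THEN conjunct1]
lemmas C_k_cos = C_k_sin_cos[THEN conjunct2]
lemmas C_k_scaleR = C_k_bilinear[OF bounded_bilinear_scaleR]
lemmas C_k_inner = C_k_bilinear[OF bounded_bilinear_inner]

lemma bounded_bilinear_qmult: "bounded_bilinear (\<odot>)"
  using bilinear_qmult by (simp add: bilinear_conv_bounded_bilinear)

lemmas C_k_qmult = C_k_bilinear[OF bounded_bilinear_qmult]

lemma bounded_linear_qcnj: "bounded_linear qcnj"
  unfolding linear_conv_bounded_linear[symmetric]
  by (auto simp: linear_iff quat_eq_iff qcnj_def)

lemmas C_k_qcnj = C_k_bounded_linear[OF bounded_linear_qcnj]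

lemma C_k_norm:
  assumes "\<And>x. f x \<noteq> 0" "C_k k f"
  shows "C_k k (\<lambda>x. norm (f x))"
  unfolding norm_eq_sqrt_inner using assms
  by (intro C_k_sqrt C_k_inner) auto

lemmas C_k_intros = C_k_const C_k_id C_k_add C_k_diff C_k_uminus C_k_mult C_k_scaleR C_k_inner
  C_k_sin C_k_cos C_k_inverse C_k_sqrt C_k_norm C_k_qmult C_k_qcnj


section \<open>Smoothness and periodicity\<close>

text \<open>
  The common form of the two loops: a lift of the curve \<open>4 i + 2 \<gamma>\<close> through the Hopf map.
\<close>

abbreviation lifted_loop :: "real \<Rightarrow> real \<Rightarrow> quat" where
  "lifted_loop lam s \<equiv> quat_sigma (4 *\<^sub>R qi + 2 *\<^sub>R gamma_curve lam s)"

lemma C_k_gamma_curve: "C_k k (gamma_curve lam)"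
  unfolding gamma_curve_def[abs_def] by (intro C_k_intros)

lemma C_k_quat_sigma:
  assumes "\<And>x. norm (f x) + f x \<bullet> qi > 0" "C_k k f"
  shows "C_k k (\<lambda>x. quat_sigma (f x))"
proof -
  have "f x \<noteq> 0" for x
    using assms(1)[of x] by auto
  moreover have "2 * (norm (f x) + f x \<bullet> qi) > 0" for x
    using assms(1)[of x] by simp
  moreover from this have "sqrt (2 * (norm (f x) + f x \<bullet> qi)) \<noteq> 0" for x
    using real_sqrt_gt_zero less_irrefl by metis
  ultimately show ?thesis
    unfolding quat_sigma_def using assms(2) by (intro C_k_intros)
qed

lemma C_k_lifted_loop:
  assumes "0 < lam" "lam < 1/2"
  shows "C_k k (lifted_loop lam)"
  using assms by (intro C_k_quat_sigma quat_sigma_argument C_k_intros C_k_gamma_curve)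

lemma C_k_loop_d: "C_k k loop_d"
  unfolding loop_d_def[abs_def] by (intro C_k_lifted_loop) simp_all

lemma C_k_loop_c: "C_k k loop_c"
  unfolding loop_c_def[abs_def] by (intro C_k_qcnj C_k_lifted_loop) simp_all

lemma C_k_qexpi: "C_k k qexpi"
  unfolding qexpi_def[abs_def] by (intro C_k_intros)

lemma C_infinity_h22: "C_infinity h22"
proof -
  have L: "bounded_linear (\<lambda>z::(real^2)\<times>(real^2). fst z $ i)"
    "bounded_linear (\<lambda>z::(real^2)\<times>(real^2). snd z $ i)" for i
    by (intro bounded_linear_intros bounded_linear_compose[OF bounded_linear_vec_nth])+
  show ?thesis
    unfolding C_infinity_def h22_def Let_def case_prod_beta
    by (intro allI C_k_qmult C_k_compose_bounded_linear[OF _ C_k_qexpi]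
        C_k_compose_bounded_linear[OF _ C_k_loop_c] C_k_compose_bounded_linear[OF _ C_k_loop_d] L)
qed

lemma sin_cos_multiple_periodic:
  "sin (numeral n * (s + 2 * pi)) = sin (numeral n * s)"
  "cos (numeral n * (s + 2 * pi)) = cos (numeral n * s)" for s :: real
  using sin_2npi[of "numeral n"] cos_2npi[of "numeral n"]
  by (simp_all add: distrib_left sin_add cos_add mult_ac)

lemma gamma_curve_periodic: "gamma_curve lam (s + 2 * pi) = gamma_curve lam s"
  unfolding gamma_curve_def by (simp only: sin_cos_multiple_periodic) simp

lemma torus_periodic_h22: "torus_periodic h22"
proof -
  have "qexpi (x + 2 * pi) = qexpi x" "loop_c (x + 2 * pi) = loop_c x"
    "loop_d (x + 2 * pi) = loop_d x" for x
    by (simp_all add: qexpi_def loop_c_def loop_d_def gamma_curve_periodic)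
  then show ?thesis
    by (auto simp: torus_periodic_def h22_def forall_2 axis_def)
qed

section \<open>The section of the Hopf map and the derivative of the curves\<close>

text \<open>
  With \<open>N = \<rho> - \<xi> i\<close> one has \<open>N i = \<rho> i + \<xi>\<close> and \<open>qcnj N = \<rho> - i \<xi>\<close>, and because
  \<open>i \<xi> + \<xi> i = - 2 \<xi>\<^sub>1\<close> and \<open>\<xi> \<xi> = - \<rho>\<^sup>2\<close>, the product \<open>N i (qcnj N)\<close> is \<open>2 (\<rho> + \<xi>\<^sub>1) \<xi>\<close>.  The normalising
  factor of \<open>quat_sigma\<close> is the square root of exactly this scalar.
\<close>

lemma quat_sigma_conjugates_i:
  assumes "\<xi> $ 1 = 0" "norm \<xi> + \<xi> \<bullet> qi > 0"
  shows "quat_sigma \<xi> \<odot> qi \<odot> qcnj (quat_sigma \<xi>) = \<xi>"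
proof -
  define r where "r = norm \<xi>"
  define D where "D = 2 * (r + \<xi> $ 2)"
  define N where "N = r *\<^sub>R qone - \<xi> \<odot> qi"
  have inner: "\<xi> \<bullet> qi = \<xi> $ 2"
    by (simp add: inner_vec_def sum_4 qi_def)
  have D: "D > 0"
    using assms(2) by (simp add: D_def r_def inner)
  have r2: "r * r = \<xi>$2 * \<xi>$2 + \<xi>$3 * \<xi>$3 + \<xi>$4 * \<xi>$4"
    using assms(1) by (simp add: r_def norm_eq_sqrt_inner inner_vec_def sum_4)
  have N: "N \<odot> qi \<odot> qcnj N = D *\<^sub>R \<xi>"
    using assms(1) r2
    unfolding quat_eq_iff N_def D_def
    by (simp add: qmult_def qcnj_def qone_def qi_def) algebra
  have s: "quat_sigma \<xi> = inverse (sqrt D) *\<^sub>R N"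
    by (simp add: quat_sigma_def N_def D_def r_def inner)
  have "quat_sigma \<xi> \<odot> qi \<odot> qcnj (quat_sigma \<xi>) = (inverse (sqrt D) * inverse (sqrt D)) *\<^sub>R (N \<odot> qi \<odot> qcnj N)"
    unfolding s by (simp add: quat_eq_iff qmult_def qcnj_def algebra_simps)
  also have "\<dots> = \<xi>"
    unfolding N using D by (simp flip: inverse_mult_distrib)
  finally show ?thesis .
qed

definition gamma_tangent :: "real \<Rightarrow> real \<Rightarrow> quat" where
  "gamma_tangent lam s =
    (1 - 2 * lam * sin (3 * s)) *\<^sub>R (cos s *\<^sub>R qi + sin s *\<^sub>R qj + (lam + sin (3 * s)) *\<^sub>R qk)"

lemma gamma_curve_has_vector_derivative:
  "(gamma_curve lam has_vector_derivative gamma_tangent lam s) (at s)"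
proof -
  \<comment> \<open>Writing \<open>2s = 3s - s\<close>, \<open>4s = 3s + s\<close>, \<open>6s = 3s + 3s\<close> brings out the common factor of the three
    coordinates.\<close>
  have "2 * s = 3 * s - s" "4 * s = 3 * s + s" "6 * s = 3 * s + 3 * s"
    by simp_all
  then have trig: "sin (2 * s) = sin (3 * s) * cos s - cos (3 * s) * sin s"
    "cos (2 * s) = cos (3 * s) * cos s + sin (3 * s) * sin s"
    "sin (4 * s) = sin (3 * s) * cos s + cos (3 * s) * sin s"
    "cos (4 * s) = cos (3 * s) * cos s - sin (3 * s) * sin s"
    "cos (6 * s) = 1 - 2 * (sin (3 * s))\<^sup>2"
    by (simp_all only: sin_diff cos_diff sin_add cos_add cos_squared_eq power2_eq_square[symmetric])
  have raw: "((\<lambda>s. sin s + lam / 2 * cos (2 * s) + lam / 4 * cos (4 * s)) has_real_derivative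
      cos s - lam * sin (2 * s) - lam * sin (4 * s)) (at s)"
    "((\<lambda>s. - cos s - lam / 2 * sin (2 * s) + lam / 4 * sin (4 * s)) has_real_derivative
      sin s - lam * cos (2 * s) + lam * cos (4 * s)) (at s)"
    "((\<lambda>s. - (1 - 2 * lam\<^sup>2) / 3 * cos (3 * s) + lam / 6 * sin (6 * s)) has_real_derivative
      (1 - 2 * lam\<^sup>2) * sin (3 * s) + lam * cos (6 * s)) (at s)"
    by (auto intro!: derivative_eq_intros simp: field_simps)
  have factored: "cos s - lam * sin (2 * s) - lam * sin (4 * s) = (1 - 2 * lam * sin (3 * s)) * cos s"
    "sin s - lam * cos (2 * s) + lam * cos (4 * s) = (1 - 2 * lam * sin (3 * s)) * sin s"
    "(1 - 2 * lam\<^sup>2) * sin (3 * s) + lam * cos (6 * s)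
      = (1 - 2 * lam * sin (3 * s)) * (lam + sin (3 * s))"
    unfolding trig by algebra+
  have combine: "((\<lambda>s. f s *\<^sub>R qi + g s *\<^sub>R qj + h s *\<^sub>R qk) has_vector_derivative
      f' *\<^sub>R qi + g' *\<^sub>R qj + h' *\<^sub>R qk) (at s)"
    if "(f has_real_derivative f') (at s)" "(g has_real_derivative g') (at s)"
      "(h has_real_derivative h') (at s)" for f g h f' g' h'
    using that by (auto intro!: derivative_eq_intros)
  show ?thesis
    using combine[OF raw[unfolded factored]]
    unfolding gamma_curve_def[abs_def] gamma_tangent_def scaleR_add_right scaleR_scaleR .
qed

section \<open>Products of two planes of quaternions\<close>

lemma qmult_commute_iff:
  "P \<odot> Q = Q \<odot> P \<longleftrightarrow> P$3 * Q$4 = P$4 * Q$3 \<and> P$4 * Q$2 = P$2 * Q$4 \<and> P$2 * Q$3 = P$3 * Q$2"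
  by (auto simp: quat_eq_iff qmult_def algebra_simps)

text \<open>Real parts are central, so only the imaginary parts decide whether two quaternions
  commute; \<open>P - qcnj P\<close> is twice the imaginary part of \<open>P\<close>.\<close>

lemma qmult_commute_iff_imaginary:
  assumes "P - qcnj P = 2 *\<^sub>R u" "Q - qcnj Q = 2 *\<^sub>R v"
  shows "P \<odot> Q = Q \<odot> P \<longleftrightarrow> u \<odot> v = v \<odot> u"
proof -
  have "P$2 = u$2" "P$3 = u$3" "P$4 = u$4" "Q$2 = v$2" "Q$3 = v$3" "Q$4 = v$4"
    using assms by (simp_all add: quat_eq_iff qcnj_def)
  then show ?thesis
    by (simp add: qmult_commute_iff)
qed

lemma qcnj_qmult: "qcnj (a \<odot> b) = qcnj b \<odot> qcnj a"
  by (simp add: quat_eq_iff qmult_def qcnj_def algebra_simps)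

lemma qcnj_qcnj: "qcnj (qcnj a) = a"
  by (simp add: quat_eq_iff qcnj_def)

lemma qcnj_qmult_self: "qcnj a \<odot> a = (a \<bullet> a) *\<^sub>R qone" "a \<odot> qcnj a = (a \<bullet> a) *\<^sub>R qone"
  by (simp_all add: quat_eq_iff qmult_def qcnj_def qone_def inner_vec_def sum_4)

lemma qmult_scaleR: "(r *\<^sub>R a) \<odot> b = r *\<^sub>R (a \<odot> b)" "a \<odot> (r *\<^sub>R b) = r *\<^sub>R (a \<odot> b)"
  using bilinear_lmul[OF bilinear_qmult] bilinear_rmul[OF bilinear_qmult] by auto

lemma qmult_add: "(a + b) \<odot> c = a \<odot> c + b \<odot> c" "a \<odot> (b + c) = a \<odot> b + a \<odot> c"
  using bilinear_ladd[OF bilinear_qmult] bilinear_radd[OF bilinear_qmult] by auto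

lemma qmult_zero: "0 \<odot> a = 0" "a \<odot> 0 = 0"
  using bilinear_lzero[OF bilinear_qmult] bilinear_rzero[OF bilinear_qmult] by auto

text \<open>The quaternions are a division algebra: a nonzero \<open>a\<close> is cancelled by multiplying with
  its conjugate.\<close>

lemma qmult_eq_zero_iff: "a \<odot> b = 0 \<longleftrightarrow> a = 0 \<or> b = 0"
proof
  assume "a \<odot> b = 0"
  then have "qcnj a \<odot> a \<odot> b = 0"
    by (simp add: qmult_assoc qmult_zero)
  then show "a = 0 \<or> b = 0"
    by (simp add: qcnj_qmult_self qmult_scaleR qmult_one)
qed (auto simp: qmult_zero)

text \<open>
  Taking the commutator of a relation \<open>x + y P + z Q + w P Q = 0\<close> with \<open>P\<close> eliminates \<open>x\<close> and \<open>y\<close>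
  and leaves \<open>(z + w P) (P Q - Q P) = 0\<close>.  The second factor is nonzero, so \<open>z + w P = 0\<close>; since a
  real \<open>P\<close> would commute with \<open>Q\<close>, both \<open>z\<close> and \<open>w\<close> vanish, and then so do \<open>x\<close> and \<open>y\<close>.
\<close>

lemma one_P_Q_PQ_independent:
  assumes nc: "P \<odot> Q \<noteq> Q \<odot> P"
    and eq: "x *\<^sub>R qone + y *\<^sub>R P + z *\<^sub>R Q + w *\<^sub>R (P \<odot> Q) = 0"
  shows "x = 0 \<and> y = 0 \<and> z = 0 \<and> w = 0"
proof -
  have not_real: "b = 0" if "a *\<^sub>R qone + b *\<^sub>R P = 0" for a b
  proof (rule ccontr)
    assume "b \<noteq> 0"
    moreover have "b * P$2 = 0" "b * P$3 = 0" "b * P$4 = 0"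
      using that by (simp_all add: quat_eq_iff qone_def)
    ultimately show False
      using nc by (simp add: qmult_commute_iff)
  qed
  define E where "E = x *\<^sub>R qone + y *\<^sub>R P + z *\<^sub>R Q + w *\<^sub>R (P \<odot> Q)"
  have "(z *\<^sub>R qone + w *\<^sub>R P) \<odot> (P \<odot> Q - Q \<odot> P) = P \<odot> E - E \<odot> P"
    by (simp add: E_def quat_eq_iff qmult_def qone_def algebra_simps)
  also have "\<dots> = 0"
    by (simp add: E_def eq qmult_zero)
  finally have zw: "z *\<^sub>R qone + w *\<^sub>R P = 0"
    using nc by (simp add: qmult_eq_zero_iff)
  then have w: "w = 0"
    by (rule not_real)
  with zw have z: "z = 0"
    by (simp add: quat_eq_iff qone_def)
  have xy: "x *\<^sub>R qone + y *\<^sub>R P = 0"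
    using eq w z by simp
  then have y: "y = 0"
    by (rule not_real)
  with xy have "x = 0"
    by (simp add: quat_eq_iff qone_def)
  with w z y show ?thesis
    by simp
qed

text \<open>
  Multiplication by \<open>qcnj F\<^sub>1\<close> on the left and by \<open>qcnj G\<^sub>2\<close> on the right reduces the products
  to the family \<open>1, P, Q, P \<odot> Q\<close> of the preceding lemma.
\<close>

lemma product_of_planes_independent:
  assumes nc: "(qcnj F1 \<odot> F2) \<odot> (G1 \<odot> qcnj G2) \<noteq> (G1 \<odot> qcnj G2) \<odot> (qcnj F1 \<odot> F2)"
    and eq: "a *\<^sub>R (F1 \<odot> G1) + b *\<^sub>R (F1 \<odot> G2) + c *\<^sub>R (F2 \<odot> G1) + d *\<^sub>R (F2 \<odot> G2) = 0"
  shows "a = 0 \<and> b = 0 \<and> c = 0 \<and> d = 0"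
proof -
  define P Q where "P = qcnj F1 \<odot> F2" and "Q = G1 \<odot> qcnj G2"
  define m n where "m = F1 \<bullet> F1" and "n = G2 \<bullet> G2"
  have "qcnj 0 = 0"
    by (simp add: quat_eq_iff qcnj_def)
  then have "F1 \<noteq> 0" "G2 \<noteq> 0"
    using nc by (auto simp: qmult_zero)
  then have mn: "m \<noteq> 0" "n \<noteq> 0"
    by (simp_all add: m_def n_def)
  have terms: "qcnj F1 \<odot> (F1 \<odot> G1) \<odot> qcnj G2 = m *\<^sub>R Q"
    "qcnj F1 \<odot> (F1 \<odot> G2) \<odot> qcnj G2 = (m * n) *\<^sub>R qone"
    "qcnj F1 \<odot> (F2 \<odot> G1) \<odot> qcnj G2 = P \<odot> Q"
    "qcnj F1 \<odot> (F2 \<odot> G2) \<odot> qcnj G2 = n *\<^sub>R P"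
    by (simp_all only: P_def Q_def m_def n_def qmult_assoc qcnj_qmult_self qmult_scaleR qmult_one
        flip: qmult_assoc[of "qcnj F1" F1]) (simp_all add: mult.commute)
  have "0 = qcnj F1 \<odot> (a *\<^sub>R (F1 \<odot> G1) + b *\<^sub>R (F1 \<odot> G2) + c *\<^sub>R (F2 \<odot> G1) + d *\<^sub>R (F2 \<odot> G2)) \<odot> qcnj G2"
    unfolding eq by (simp add: qmult_zero)
  also have "\<dots> = (b * m * n) *\<^sub>R qone + (d * n) *\<^sub>R P + (a * m) *\<^sub>R Q + c *\<^sub>R (P \<odot> Q)"
    by (simp add: qmult_add qmult_scaleR terms mult.assoc)
  finally show ?thesis
    using one_P_Q_PQ_independent[of P Q "b * m * n" "d * n" "a * m" c] nc mn
    by (simp add: P_def Q_def)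
qed

section \<open>Mixed partials\<close>

text \<open>
  In the presence of the right number of vectors, linear independence of the indexed family gives
  all three parts of the basis condition.  The indexed family is the image of the standard basis
  of \<open>real^('a \<times> 'b)\<close> under the linear map \<open>T\<close> that forms linear combinations, so both injectivity
  and independence are inherited from injectivity of \<open>T\<close>.
\<close>

lemma invertible_mixed_hessianI:
  fixes h :: "(real^'a) \<times> (real^'b) \<Rightarrow> real^'n"
  assumes "CARD('n) = CARD('a) * CARD('b)"
    and "\<And>a. (\<Sum>k\<in>UNIV. a k *\<^sub>R mixed_partial h p q k) = 0 \<Longrightarrow> (\<forall>k. a k = 0)"
  shows "invertible_mixed_hessian h p q"
proof -
  define M where "M = mixed_partial h p q"
  define T where "T = (\<lambda>a::real^('a\<times>'b). \<Sum>k\<in>UNIV. a $ k *\<^sub>R M k)"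
  have lin: "linear T"
    by (auto simp: linear_iff T_def algebra_simps sum.distrib scaleR_sum_right)
  have inj: "inj T"
    unfolding linear_injective_0[OF lin]
    using assms(2) by (auto simp: T_def M_def vec_eq_iff)
  have T_axis: "T (axis k 1) = M k" for k
    by (simp add: T_def axis_def if_distrib[of "\<lambda>x. x *\<^sub>R _"] cong: if_cong)
  then have M: "M = T \<circ> (\<lambda>k. axis k 1)"
    by auto
  have injM: "inj M"
    unfolding M by (intro inj_compose inj) (auto simp: inj_on_def axis_eq_axis)
  have "independent (range (\<lambda>k::'a\<times>'b. axis k (1::real)))"
    by (rule independent_mono[OF independent_Basis]) (auto simp: Basis_vec_def)
  then have ind: "independent (range M)"
    unfolding M image_comp[symmetric]
    using inj by (intro linear_independent_injective_image[OF lin]) (auto intro: inj_on_subset)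
  have "card (range M) = DIM(real^'n)"
    using card_image[OF injM] assms(1) by simp
  then have "span (range M) = UNIV"
    using card_ge_dim_independent[OF subset_UNIV ind] by auto
  then show ?thesis
    using injM ind by (simp add: invertible_mixed_hessian_def M_def)
qed

text \<open>
  The inner derivative in \<open>v\<close> is \<open>F (p + u e\<^sub>i) \<odot> G'\<close> for every \<open>u\<close>, so the outer one only sees \<open>F\<close>.
\<close>

lemma mixed_partial_qmult:
  assumes "((\<lambda>u. F (p + u *\<^sub>R axis i 1)) has_vector_derivative F') (at 0)"
    and "((\<lambda>v. G (q + v *\<^sub>R axis \<alpha> 1)) has_vector_derivative G') (at 0)"
  shows "mixed_partial (\<lambda>(p, q). F p \<odot> G q) p q (i, \<alpha>) = F' \<odot> G'"
proof -
  have "((\<lambda>v. F p' \<odot> G (q + v *\<^sub>R axis \<alpha> 1)) has_vector_derivative F p' \<odot> G') (at 0)" for p'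
    using bounded_linear.has_vector_derivative[OF
        bounded_bilinear.bounded_linear_right[OF bounded_bilinear_qmult] assms(2)] .
  then have "vector_derivative (\<lambda>v. F p' \<odot> G (q + v *\<^sub>R axis \<alpha> 1)) (at 0) = F p' \<odot> G'" for p'
    by (rule vector_derivative_at)
  moreover have "((\<lambda>u. F (p + u *\<^sub>R axis i 1) \<odot> G') has_vector_derivative F' \<odot> G') (at 0)"
    using bounded_linear.has_vector_derivative[OF
        bounded_bilinear.bounded_linear_left[OF bounded_bilinear_qmult] assms(1)] .
  ultimately show ?thesis
    by (simp add: mixed_partial_def vector_derivative_at)
qed

section \<open>The tangents of the curves and their lifts\<close>

text \<open>
  For imaginary quaternions, commuting means being parallel.  The positive factor
  \<open>1 - 2 \<lambda> sin 3s\<close>, where \<open>\<lambda> < 1/2\<close> matters, can be dropped; the remaining comparison of directions uses that \<open>sin 3s\<close> changes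
  sign together with \<open>cos s\<close> and \<open>sin s\<close> when \<open>s\<close> is shifted by \<open>\<pi>\<close>.
\<close>

lemma gamma_tangents_do_not_commute:
  assumes lam: "0 < lam" "lam < 1/2" and mu: "0 < mu" "mu < 1/2" and "lam \<noteq> mu"
  shows "gamma_tangent lam s \<odot> gamma_tangent mu t \<noteq> gamma_tangent mu t \<odot> gamma_tangent lam s"
proof
  assume comm: "gamma_tangent lam s \<odot> gamma_tangent mu t = gamma_tangent mu t \<odot> gamma_tangent lam s"
  have factor_pos: "1 - 2 * c * sin x > 0" if "0 < c" "c < 1/2" for c x :: real
  proof -
    have "2 * c * sin x \<le> 2 * c"
      using that mult_left_mono[of "sin x" 1 "2 * c"] by simp
    with that show ?thesis
      by linarith
  qed
  define T where "T = (\<lambda>c x::real. cos x *\<^sub>R qi + sin x *\<^sub>R qj + (c + sin (3 * x)) *\<^sub>R qk)"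
  define K where "K = (\<lambda>c x::real. 1 - 2 * c * sin (3 * x))"
  have KT: "gamma_tangent c x = K c x *\<^sub>R T c x" for c x
    by (simp add: gamma_tangent_def K_def T_def)
  have "K lam s \<noteq> 0" "K mu t \<noteq> 0"
    using factor_pos[OF lam, of "3 * s"] factor_pos[OF mu, of "3 * t"] by (simp_all add: K_def)
  then have "T lam s \<odot> T mu t = T mu t \<odot> T lam s"
    using comm by (simp add: KT qmult_scaleR mult.commute)
  then have cross: "sin s * (mu + sin (3 * t)) = (lam + sin (3 * s)) * sin t"
    "(lam + sin (3 * s)) * cos t = cos s * (mu + sin (3 * t))"
    "cos s * sin t = sin s * cos t"
    by (simp_all add: qmult_commute_iff T_def qi_def qj_def qk_def)
  \<comment> \<open>The sign \<open>e\<close> distinguishes equal from opposite points of the unit circle.\<close>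
  define e where "e = cos (s - t)"
  have "sin (s - t) = 0"
    using cross(3) by (simp add: sin_diff)
  then have e: "e = 1 \<or> e = -1"
    using sin_cos_squared_add[of "s - t"] by (simp add: e_def power2_eq_1_iff)
  have "sin t = sin (s - (s - t))" "cos t = cos (s - (s - t))"
    by simp_all
  then have t: "sin t = e * sin s" "cos t = e * cos s"
    unfolding sin_diff[of s "s - t"] cos_diff[of s "s - t"] by (simp_all add: \<open>sin (s - t) = 0\<close> e_def)
  have sin3: "sin (3 * t) = e * sin (3 * s)"
  proof -
    have "sin (3 * x) = 3 * sin x - 4 * sin x ^ 3" for x :: real
    proof -
      have "sin (3 * x) = sin (2 * x + x)"
        by simp
      then show ?thesis
        unfolding sin_add sin_double cos_double using sin_cos_squared_add[of x] by algebra
    qed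
    then show ?thesis
      using e by (auto simp: t)
  qed
  then have "sin s * (mu - e * lam) = 0" "cos s * (mu - e * lam) = 0"
    using cross(1,2) e by (auto simp: t sin3 algebra_simps)
  then have "mu = e * lam"
    using sin_cos_squared_add[of s] by (auto simp: power2_eq_square)
  then show False
    using e assms by auto
qed

text \<open>
  Differentiating \<open>g \<odot> i \<odot> qcnj g = 4 i + 2 \<gamma>\<close> gives \<open>X - qcnj X = 2 \<gamma>'\<close> for
  \<open>X = g' \<odot> i \<odot> qcnj g\<close>, because the other summand \<open>g \<odot> i \<odot> qcnj g'\<close> is \<open>- qcnj X\<close>.  In this way the
  explicit derivative of \<open>quat_sigma\<close> never has to be computed.
\<close>

lemma lifted_loop_derivative:
  assumes "0 < lam" "lam < 1/2"
  obtains g' where "(lifted_loop lam has_vector_derivative g') (at s)"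
    "g' \<odot> qi \<odot> qcnj (lifted_loop lam s) - qcnj (g' \<odot> qi \<odot> qcnj (lifted_loop lam s))
      = 2 *\<^sub>R gamma_tangent lam s"
proof -
  let ?g = "lifted_loop lam"
  have "C_k 1 ?g"
    using assms by (intro C_k_lifted_loop)
  then have "?g differentiable (at s)"
    by simp
  then obtain g' where g': "(?g has_vector_derivative g') (at s)"
    using vector_derivative_works by blast
  have "((\<lambda>s. ?g s \<odot> qi \<odot> qcnj (?g s)) has_vector_derivative
      ?g s \<odot> qi \<odot> qcnj g' + g' \<odot> qi \<odot> qcnj (?g s)) (at s)"
    by (intro bounded_bilinear.has_vector_derivative[OF bounded_bilinear_qmult]
        bounded_linear.has_vector_derivative[OF bounded_linear_qcnj] g'
        bounded_linear.has_vector_derivative[OF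
          bounded_bilinear.bounded_linear_left[OF bounded_bilinear_qmult]])
  moreover have "?g s \<odot> qi \<odot> qcnj (?g s) = 4 *\<^sub>R qi + 2 *\<^sub>R gamma_curve lam s" for s
    using assms by (intro quat_sigma_conjugates_i quat_sigma_argument)
  ultimately have "((\<lambda>s. 4 *\<^sub>R qi + 2 *\<^sub>R gamma_curve lam s) has_vector_derivative
      ?g s \<odot> qi \<odot> qcnj g' + g' \<odot> qi \<odot> qcnj (?g s)) (at s)"
    by (simp only:)
  moreover have "((\<lambda>s. 4 *\<^sub>R qi + 2 *\<^sub>R gamma_curve lam s) has_vector_derivative
      0 + 2 *\<^sub>R gamma_tangent lam s) (at s)"
    by (intro has_vector_derivative_add has_vector_derivative_const gamma_curve_has_vector_derivative
        bounded_linear.has_vector_derivative[OF bounded_linear_scaleR_right])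
  ultimately have "?g s \<odot> qi \<odot> qcnj g' + g' \<odot> qi \<odot> qcnj (?g s) = 0 + 2 *\<^sub>R gamma_tangent lam s"
    by (rule vector_derivative_unique_at)
  moreover have "?g s \<odot> qi \<odot> qcnj g' = - qcnj (g' \<odot> qi \<odot> qcnj (?g s))"
    by (simp add: quat_eq_iff qmult_def qcnj_def qi_def)
  ultimately show thesis
    using g' that[of g'] by simp
qed

section \<open>The mixed Hessian of the map\<close>

lemma invertible_mixed_hessian_h22: "invertible_mixed_hessian h22 p q"
proof (rule invertible_mixed_hessianI)
  define x s t y where "x = p $ 1" and "s = p $ 2" and "t = q $ 1" and "y = q $ 2"
  obtain g' where g': "(lifted_loop (1/4) has_vector_derivative g') (at s)"
    "g' \<odot> qi \<odot> qcnj (lifted_loop (1/4) s) - qcnj (g' \<odot> qi \<odot> qcnj (lifted_loop (1/4) s))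
      = 2 *\<^sub>R gamma_tangent (1/4) s"
    using lifted_loop_derivative[of "1/4" s] by auto
  obtain d' where d': "(lifted_loop (1/8) has_vector_derivative d') (at t)"
    "d' \<odot> qi \<odot> qcnj (lifted_loop (1/8) t) - qcnj (d' \<odot> qi \<odot> qcnj (lifted_loop (1/8) t))
      = 2 *\<^sub>R gamma_tangent (1/8) t"
    using lifted_loop_derivative[of "1/8" t] by auto
  define F G where "F = (\<lambda>p::real^2. qexpi (p$1) \<odot> loop_c (p$2))"
    and "G = (\<lambda>q::real^2. loop_d (q$1) \<odot> qexpi (q$2))"
  \<comment> \<open>In \<open>G2\<close> the factor \<open>e\<^sup>y\<^sup>i\<close> stands last, next to its conjugate in \<open>G1 \<odot> qcnj G2\<close>.\<close>
  define F1 F2 where "F1 = qexpi x \<odot> qi \<odot> loop_c s" and "F2 = qexpi x \<odot> qcnj g'"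
  define G1 G2 where "G1 = d' \<odot> qexpi y" and "G2 = loop_d t \<odot> (qi \<odot> qexpi y)"
  have h22: "h22 = (\<lambda>(p, q). F p \<odot> G q)"
    by (auto simp: h22_def F_def G_def qmult_assoc)
  have c': "(loop_c has_vector_derivative qcnj g') (at s)"
    unfolding loop_c_def[abs_def]
    by (rule bounded_linear.has_vector_derivative[OF bounded_linear_qcnj g'(1)])
  have d'': "(loop_d has_vector_derivative d') (at t)"
    unfolding loop_d_def[abs_def] by (rule d'(1))
  have e': "(qexpi has_vector_derivative qexpi z \<odot> qi) (at z)" for z
  proof -
    have "qexpi z \<odot> qi = - sin z *\<^sub>R qone + cos z *\<^sub>R qi"
      by (simp add: quat_eq_iff qexpi_def qmult_def qone_def qi_def)
    then show ?thesis
      unfolding qexpi_def[abs_def] by (auto intro!: derivative_eq_intros)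
  qed
  have e_comm: "qexpi z \<odot> qi = qi \<odot> qexpi z" for z
    by (simp add: quat_eq_iff qexpi_def qmult_def qone_def qi_def)
  have shift: "((\<lambda>u. f (a + u)) has_vector_derivative f') (at 0)"
    if "(f has_vector_derivative f') (at a)" for f :: "real \<Rightarrow> quat" and f' a
    using vector_diff_chain_at[of "\<lambda>u. a + u" 1 0 f f'] that
      has_vector_derivative_add[OF has_vector_derivative_const[of a] has_vector_derivative_id]
    by (simp add: o_def)
  note left = bounded_linear.has_vector_derivative[OF
          bounded_bilinear.bounded_linear_left[OF bounded_bilinear_qmult]]
  note right = bounded_linear.has_vector_derivative[OF
          bounded_bilinear.bounded_linear_right[OF bounded_bilinear_qmult]]
  have "((\<lambda>u. qexpi (x + u) \<odot> loop_c s) has_vector_derivative F1) (at 0)"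
    unfolding F1_def by (rule left[OF shift[OF e']])
  moreover have "((\<lambda>u. qexpi x \<odot> loop_c (s + u)) has_vector_derivative F2) (at 0)"
    unfolding F2_def by (rule right[OF shift[OF c']])
  moreover have "((\<lambda>u. loop_d (t + u) \<odot> qexpi y) has_vector_derivative G1) (at 0)"
    unfolding G1_def by (rule left[OF shift[OF d'']])
  moreover have "((\<lambda>u. loop_d t \<odot> qexpi (y + u)) has_vector_derivative G2) (at 0)"
    unfolding G2_def by (rule right[OF shift[OF e'[unfolded e_comm]]])
  moreover have "F (p + u *\<^sub>R axis 1 1) = qexpi (x + u) \<odot> loop_c s"
    "F (p + u *\<^sub>R axis 2 1) = qexpi x \<odot> loop_c (s + u)"
    "G (q + u *\<^sub>R axis 1 1) = loop_d (t + u) \<odot> qexpi y"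
    "G (q + u *\<^sub>R axis 2 1) = loop_d t \<odot> qexpi (y + u)" for u
    by (simp_all add: F_def G_def axis_def x_def s_def t_def y_def)
  ultimately have partials:
    "((\<lambda>u. F (p + u *\<^sub>R axis 1 1)) has_vector_derivative F1) (at 0)"
    "((\<lambda>u. F (p + u *\<^sub>R axis 2 1)) has_vector_derivative F2) (at 0)"
    "((\<lambda>u. G (q + u *\<^sub>R axis 1 1)) has_vector_derivative G1) (at 0)"
    "((\<lambda>u. G (q + u *\<^sub>R axis 2 1)) has_vector_derivative G2) (at 0)"
    by (simp_all only:)
  note mixed = mixed_partial_qmult[OF partials(1) partials(3), folded h22]
    mixed_partial_qmult[OF partials(1) partials(4), folded h22]
    mixed_partial_qmult[OF partials(2) partials(3), folded h22]
    mixed_partial_qmult[OF partials(2) partials(4), folded h22]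
  have unit: "qexpi z \<bullet> qexpi z = 1" for z
    by (simp add: qexpi_def qone_def qi_def inner_vec_def sum_4 power2_eq_square[symmetric])
  have cancel: "qcnj (qexpi z) \<odot> (qexpi z \<odot> w) = w" "qexpi z \<odot> (qcnj (qexpi z) \<odot> w) = w" for z w
    by (simp_all add: qcnj_qmult_self unit qmult_one flip: qmult_assoc)
  \<comment> \<open>The unit factors cancel, leaving the quaternions whose imaginary parts are the tangents.\<close>
  define X Y where "X = g' \<odot> qi \<odot> qcnj (lifted_loop (1/4) s)"
    and "Y = d' \<odot> qi \<odot> qcnj (lifted_loop (1/8) t)"
  have P: "qcnj F1 \<odot> F2 = qcnj X"
    by (simp add: F1_def F2_def X_def loop_c_def qcnj_qmult qmult_assoc cancel qcnj_qcnj)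
  have Q: "G1 \<odot> qcnj G2 = - Y"
  proof -
    have "qcnj qi = - qi"
      by (simp add: quat_eq_iff qcnj_def qi_def)
    then show ?thesis
      by (simp add: G1_def G2_def Y_def loop_d_def qcnj_qmult qmult_assoc cancel
          bilinear_lneg[OF bilinear_qmult] bilinear_rneg[OF bilinear_qmult])
  qed
  have imP: "qcnj X - qcnj (qcnj X) = 2 *\<^sub>R (- gamma_tangent (1/4) s)"
    using arg_cong[OF g'(2)[folded X_def], of uminus] by (simp add: qcnj_qcnj)
  have imQ: "- Y - qcnj (- Y) = 2 *\<^sub>R (- gamma_tangent (1/8) t)"
    using arg_cong[OF d'(2)[folded Y_def], of uminus]
    by (simp add: linear_neg[OF bounded_linear.linear[OF bounded_linear_qcnj]])
  have "- gamma_tangent (1/4) s \<odot> - gamma_tangent (1/8) t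
      \<noteq> - gamma_tangent (1/8) t \<odot> - gamma_tangent (1/4) s"
    using gamma_tangents_do_not_commute[of "1/4" "1/8" s t]
    by (simp add: bilinear_lneg[OF bilinear_qmult] bilinear_rneg[OF bilinear_qmult])
  then have nc: "(qcnj F1 \<odot> F2) \<odot> (G1 \<odot> qcnj G2) \<noteq> (G1 \<odot> qcnj G2) \<odot> (qcnj F1 \<odot> F2)"
    unfolding P Q using qmult_commute_iff_imaginary[OF imP imQ] by blast
  have pairs: "(UNIV :: (2 \<times> 2) set) = {(1, 1), (1, 2), (2, 1), (2, 2)}"
    unfolding UNIV_Times_UNIV[symmetric] UNIV_2 by auto
  fix a
  assume "(\<Sum>k\<in>UNIV. a k *\<^sub>R mixed_partial h22 p q k) = 0"
  then have "a (1, 1) *\<^sub>R (F1 \<odot> G1) + a (1, 2) *\<^sub>R (F1 \<odot> G2)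
      + a (2, 1) *\<^sub>R (F2 \<odot> G1) + a (2, 2) *\<^sub>R (F2 \<odot> G2) = 0"
    by (simp add: pairs mixed add.assoc)
  from product_of_planes_independent[OF nc this] show "\<forall>k. a k = 0"
    by (simp add: forall_2 split_paired_All)
qed simp

theorem proposition10:
  shows "h22 \<in> P_set"
  using C_infinity_h22 torus_periodic_h22 invertible_mixed_hessian_h22 by (auto simp: P_set_def)

end
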